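(* Let $\alpha\in[0,1]$, $c_0>0$, and let $\vec A^+_{c_0,\alpha}=(A^+_{j,c_0,\alpha})_{j=1}^3\in\mathbb S^2$ be the limiting vector defined in the context. Then, for fixed $\alpha$, $\vec A^+_{c_0,\alpha}$ is a continuous function of $c_0>0$. Moreover, if $\alpha\in(0,1]$, the following inequalities hold true: $$|A^+_{1,c_0,\alpha}-1|\le\frac{c_0^2\pi}{\alpha}\left(1+\frac{c_0^2\pi}{8\alpha}\right),$$ $$\left|A^+_{2,c_0,\alpha}-c_0\frac{\sqrt{\pi(1+\alpha)}}{\sqrt2}\right|\le\frac{c_0^2\pi}{4}+\frac{c_0^2\pi}{\alpha\sqrt2}\left(1+\frac{c_0^2\pi}{8}+c_0\frac{\sqrt{\pi(1+\alpha)}}{2\sqrt2}\right)+\left(\frac{c_0^2\pi}{2\sqrt2\,\alpha}\right)^2,$$ $$\left|A^+_{3,c_0,\alpha}-c_0\frac{\sqrt{\pi(1-\alpha)}}{\sqrt2}\right|\le\frac{c_0^2\pi}{4}+\frac{c_0^2\pi}{\alpha\sqrt2}\left(1+\frac{c_0^2\pi}{8}+c_0\frac{\sqrt{\pi(1-\alpha)}}{2\sqrt2}\right)+\left(\frac{c_0^2\pi}{2\sqrt2\,\alpha}\right)^2.$$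
   Context: For $\alpha\in[0,1]$ put $\beta=\sqrt{1-\alpha^2}$. For $c_0>0$, $\{\vec m_{c_0,\alpha},\vec n_{c_0,\alpha},\vec b_{c_0,\alpha}\}$ denotes the unique global solution on $\mathbb R$ of the Serret--Frenet system $$\vec m'=c\,\vec n,\qquad \vec n'=-c\,\vec m+\tau\,\vec b,\qquad \vec b'=-\tau\,\vec n,$$ with $c(s)=c_0e^{-\alpha s^2/4}$, $\tau(s)=\beta s/2$ and $\vec m(0)=(1,0,0)$, $\vec n(0)=(0,1,0)$, $\vec b(0)=(0,0,1)$. The limiting vector is $\vec A^+_{c_0,\alpha}:=\lim_{s\to+\infty}\vec m_{c_0,\alpha}(s)\in\mathbb S^2$ (this limit exists). *)

theory Defs
  imports "HOL-Analysis.Analysis"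
begin

definition curvature :: "real \<Rightarrow> real \<Rightarrow> real \<Rightarrow> real" where
  "curvature c0 \<alpha> s = c0 * exp (- \<alpha> * s\<^sup>2 / 4)"

definition torsion :: "real \<Rightarrow> real \<Rightarrow> real" where
  "torsion \<alpha> s = sqrt (1 - \<alpha>\<^sup>2) * s / 2"

definition serret_frenet ::
  "real \<Rightarrow> real \<Rightarrow> (real \<Rightarrow> real^3) \<Rightarrow> (real \<Rightarrow> real^3) \<Rightarrow> (real \<Rightarrow> real^3) \<Rightarrow> bool" where
  "serret_frenet c0 \<alpha> m n b \<longleftrightarrow>
     (\<forall>s. (m has_vector_derivative curvature c0 \<alpha> s *\<^sub>R n s) (at s)) \<and>
     (\<forall>s. (n has_vector_derivative
            - curvature c0 \<alpha> s *\<^sub>R m s + torsion \<alpha> s *\<^sub>R b s) (at s)) \<and>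
     (\<forall>s. (b has_vector_derivative - torsion \<alpha> s *\<^sub>R n s) (at s)) \<and>
     m 0 = vector [1, 0, 0] \<and> n 0 = vector [0, 1, 0] \<and> b 0 = vector [0, 0, 1]"

(* The system is linear with continuous coefficients, so the global solution exists and is unique. *)
definition frenet_frame ::
  "real \<Rightarrow> real \<Rightarrow> (real \<Rightarrow> real^3) \<times> (real \<Rightarrow> real^3) \<times> (real \<Rightarrow> real^3)" where
  "frenet_frame c0 \<alpha> = (THE (m, n, b). serret_frenet c0 \<alpha> m n b)"

definition tangent :: "real \<Rightarrow> real \<Rightarrow> real \<Rightarrow> real^3" where
  "tangent c0 \<alpha> = fst (frenet_frame c0 \<alpha>)"

(* The vector A^+; the limit is known to exist for every c0 > 0 and 0 <= alpha <= 1. *)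
definition limit_vector :: "real \<Rightarrow> real \<Rightarrow> real^3" where
  "limit_vector c0 \<alpha> = Lim at_top (tangent c0 \<alpha>)"

end

theory Submission
  imports Defs
begin

text \<open>
The system is linear with continuous coefficients, so it has a global solution by Picard
iteration (\<open>linear_ode_global_solution\<close>), and its skew-symmetry gives uniqueness. The
definite description of the frame therefore denotes the solution. Each coordinate
\<open>(x, y, z)\<close> of the frame \<open>(m, n, b)\<close> solves the scalar form of the system and, by the same
skew-symmetry, remains on the unit sphere.

Continuity in \<open>c0\<close> combines two facts. At a fixed time the tangent depends continuously on
\<open>c0\<close>, since the squared distance of two solutions grows at a rate at most
\<open>2 * \<bar>c0 - c0'\<bar>\<close> (\<open>frenet_distance_le\<close>). The tangent converges as \<open>s\<close> tends to infinity, locally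
uniformly in \<open>c0\<close> (\<open>tangent_tail_bound\<close>): for \<open>\<alpha> > 0\<close> because the curvature is integrable, for
\<open>\<alpha> = 0\<close> by an integration by parts that exploits the growing torsion.

For the inequalities, rotate the normal plane by the accumulated torsion and write
\<open>P s = exp (\<i> \<beta> s\<^sup>2 / 4) * (y s + \<i> z s)\<close>. Then \<open>x' = c0 * Re (exp (- (\<alpha> + \<i> \<beta>) s\<^sup>2 / 4) * P)\<close>,
while \<open>P\<close> moves by at most the integral of the curvature. Freezing \<open>P\<close> at its initial value gives
the linear term \<open>c0 * Re (P 0 * \<integral>exp (- (\<alpha> + \<i> \<beta>) s\<^sup>2 / 4))\<close>, a complex Gaussian integral
(\<open>gaussian_integral_complex\<close>) equal to \<open>sqrt pi / csqrt (\<alpha> + \<i> \<beta>)\<close>. With \<open>P 0\<close> equal to \<open>0\<close>, \<open>1\<close>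
and \<open>\<i>\<close> in the three coordinates, its half-angle formulas are the stated linear terms. The
error is at most half the square of the total curvature of the half line, that is \<open>c0\<^sup>2 * pi / (2 * \<alpha>)\<close>
(\<open>limit_vector_first_order\<close>), which is smaller than each of the three stated bounds.
\<close>

section \<open>Global solutions of linear differential equations\<close>

lemma antiderivative_from_zero:
  fixes f :: "real \<Rightarrow> 'a::euclidean_space"
  assumes "continuous_on UNIV f"
  shows "\<exists>F. F 0 = 0 \<and> (\<forall>s. (F has_vector_derivative f s) (at s))"
proof -
  have "\<exists>F. \<forall>x::real. (-\<infinity>::ereal) < x \<longrightarrow> x < (\<infinity>::ereal) \<longrightarrow> (F has_vector_derivative f x) (at x)"
    by (rule einterval_antiderivative)
       (use assms in \<open>auto simp: continuous_on_eq_continuous_at\<close>)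
  then obtain F where F: "\<And>s. (F has_vector_derivative f s) (at s)"
    by auto
  have "((\<lambda>s. F s - F 0) has_vector_derivative f s) (at s)" for s
    by (rule derivative_eq_intros F | simp)+
  then show ?thesis
    by (intro exI[of _ "\<lambda>s. F s - F 0"]) auto
qed

text \<open>
The form of the mean value inequality on which the estimates below rest: the bound on the
derivative varies with the point and enters through an antiderivative, so that no integral
has to be evaluated.
\<close>

lemma increment_le_of_derivative_le:
  fixes f :: "real \<Rightarrow> 'a::real_normed_vector"
  assumes "a \<le> b"
    and f: "\<And>s. a \<le> s \<Longrightarrow> s \<le> b \<Longrightarrow> (f has_vector_derivative f' s) (at s)"
    and g: "\<And>s. a \<le> s \<Longrightarrow> s \<le> b \<Longrightarrow> (g has_real_derivative g' s) (at s)"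
    and le: "\<And>s. a \<le> s \<Longrightarrow> s \<le> b \<Longrightarrow> norm (f' s) \<le> g' s"
  shows "norm (f b - f a) \<le> g b - g a"
proof (cases "a = b")
  case False
  have "continuous_on {a..b} f"
    by (intro continuous_at_imp_continuous_on ballI has_vector_derivative_continuous[OF f]) auto
  moreover have "continuous_on {a..b} g"
    by (intro continuous_at_imp_continuous_on ballI DERIV_isCont[OF g]) auto
  ultimately show ?thesis
    using assms False
    by (intro differentiable_bound_general[where f' = f' and \<phi>' = g'])
       (auto simp flip: has_real_derivative_iff_has_vector_derivative)
qed simp

text \<open>
One Picard step. Since the solution is needed on the whole line, the bound is stated for both
signs of \<open>s\<close>; negative times reduce to positive ones by reflection.
\<close>

lemma iterated_integral_growth:
  fixes f :: "real \<Rightarrow> 'a::real_normed_vector"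
  assumes f: "\<And>s. (f has_vector_derivative f' s) (at s)"
    and "f 0 = 0"
    and le: "\<And>s. \<bar>s\<bar> \<le> T \<Longrightarrow> norm (f' s) \<le> M * \<bar>s\<bar> ^ k"
    and "\<bar>s\<bar> \<le> T"
  shows "norm (f s) \<le> M * \<bar>s\<bar> ^ Suc k / Suc k"
proof -
  have *: "norm (h t) \<le> M * t ^ Suc k / Suc k"
    if h: "\<And>s. (h has_vector_derivative h' s) (at s)" and "h 0 = 0"
      and h': "\<And>s. \<bar>s\<bar> \<le> T \<Longrightarrow> norm (h' s) \<le> M * \<bar>s\<bar> ^ k"
      and t: "0 \<le> t" "t \<le> T" for h h' :: "real \<Rightarrow> 'a" and t
  proof -
    have h'_le: "norm (h' s) \<le> M * s ^ k" if "0 \<le> s" "s \<le> t" for s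
      using h'[of s] that t by simp
    have "((\<lambda>s. M * s ^ Suc k / Suc k) has_real_derivative M * s ^ k) (at s)" for s
      by (rule derivative_eq_intros refl | simp add: field_simps del: of_nat_Suc power_Suc)+
    then have "norm (h t - h 0) \<le> M * t ^ Suc k / Suc k - M * 0 ^ Suc k / Suc k"
      by (intro increment_le_of_derivative_le[OF t(1) h, where g' = "\<lambda>s. M * s ^ k"] h'_le)
    then show ?thesis
      using that(2) by simp
  qed
  show ?thesis
  proof (cases "0 \<le> s")
    case True
    then show ?thesis using *[OF f assms(2) le, of s] assms(4) by auto
  next
    case False
    have "((\<lambda>s. f (- s)) has_vector_derivative - f' (- s)) (at s)" for s
    proof -
      have "((f \<circ> uminus) has_vector_derivative (- 1) *\<^sub>R f' (- s)) (at s)"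
        by (rule vector_diff_chain_at) (auto intro!: derivative_eq_intros f)
      then show ?thesis by (simp add: o_def)
    qed
    moreover have "norm (- f' (- s)) \<le> M * \<bar>s\<bar> ^ k" if "\<bar>s\<bar> \<le> T" for s
      using le[of "- s"] that by simp
    ultimately have "norm (f (- (- s))) \<le> M * (- s) ^ Suc k / Suc k"
      using False assms(2,4) by (intro *[where h' = "\<lambda>s. - f' (- s)"]) auto
    then show ?thesis
      using False by (simp add: abs_of_neg del: power_Suc of_nat_Suc)
  qed
qed

text \<open>
The Picard series \<open>\<Sum>k. u k s\<close>, with \<open>u 0 = y0\<close> and \<open>u (Suc k)\<close> the antiderivative of
\<open>A s (u k s)\<close>, converges for all times: on \<open>\<bar>s\<bar> \<le> T\<close> its terms are bounded by the exponential
series in \<open>L * T\<close>. The derivative of the partial sum of length \<open>n + 1\<close> is \<open>A s\<close> applied to the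
partial sum of length \<open>n\<close>, so the derivatives converge locally uniformly as well.
\<close>

theorem linear_ode_global_solution:
  fixes A :: "real \<Rightarrow> 'a \<Rightarrow> 'a::euclidean_space"
  assumes lin: "\<And>s. bounded_linear (A s)"
    and cont: "\<And>y. continuous_on UNIV y \<Longrightarrow> continuous_on UNIV (\<lambda>s. A s (y s))"
    and bnd: "\<And>T. \<exists>L. \<forall>s x. \<bar>s\<bar> \<le> T \<longrightarrow> norm (A s x) \<le> L * norm x"
  shows "\<exists>y. y 0 = y0 \<and> (\<forall>s. (y has_vector_derivative A s (y s)) (at s))"
proof -
  have "\<forall>f::real \<Rightarrow> 'a. \<exists>F. continuous_on UNIV f \<longrightarrow>
      F 0 = 0 \<and> (\<forall>s. (F has_vector_derivative f s) (at s))"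
    using antiderivative_from_zero by blast
  then obtain I :: "(real \<Rightarrow> 'a) \<Rightarrow> real \<Rightarrow> 'a" where I:
    "\<And>f. continuous_on UNIV f \<Longrightarrow> I f 0 = 0"
    "\<And>f s. continuous_on UNIV f \<Longrightarrow> (I f has_vector_derivative f s) (at s)"
    by metis
  define u where "u = rec_nat (\<lambda>_. y0) (\<lambda>k f. I (\<lambda>s. A s (f s)))"
  have u_simps: "u 0 = (\<lambda>_. y0)" "u (Suc k) = I (\<lambda>s. A s (u k s))" for k
    by (simp_all add: u_def)
  have u_cont: "continuous_on UNIV (u k)" for k
  proof (induction k)
    case (Suc k)
    show ?case
      unfolding u_simps
      by (intro continuous_at_imp_continuous_on ballI
            has_vector_derivative_continuous[OF I(2)] cont Suc)
  qed (simp add: u_simps)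
  have u_deriv: "(u (Suc k) has_vector_derivative A s (u k s)) (at s)" for k s
    unfolding u_simps by (intro I cont u_cont)
  have u_zero: "u (Suc k) 0 = 0" for k
    unfolding u_simps by (intro I cont u_cont)
  define Y where "Y = (\<lambda>s. \<Sum>k. u k s)"
  have Y0: "Y 0 = y0"
  proof -
    have "(\<lambda>k. u k 0) sums (\<Sum>k\<in>{0}. u k 0)"
      by (rule sums_finite) (auto simp: u_zero gr0_conv_Suc)
    then show ?thesis by (simp add: Y_def u_simps sums_iff)
  qed
  have "(Y has_vector_derivative A s (Y s)) (at s)" for s
  proof -
    define T where "T = \<bar>s\<bar> + 1"
    obtain L0 where L0: "\<And>t x. \<bar>t\<bar> \<le> T \<Longrightarrow> norm (A t x) \<le> L0 * norm x"
      using bnd[of T] by blast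
    \<comment> \<open>\<open>L0\<close> may be zero, and the uniform estimate below divides by the constant.\<close>
    define L where "L = \<bar>L0\<bar> + 1"
    have "L0 \<le> L" unfolding L_def by linarith
    then have L: "norm (A t x) \<le> L * norm x" if "\<bar>t\<bar> \<le> T" for t x
      using L0[OF that, of x] mult_right_mono[of L0 L "norm x"] by simp
    have "L > 0" by (simp add: L_def)
    have u_le: "norm (u k t) \<le> norm y0 * L ^ k / fact k * \<bar>t\<bar> ^ k" if "\<bar>t\<bar> \<le> T" for k t
      using that
    proof (induction k arbitrary: t)
      case (Suc k)
      have "norm (u (Suc k) t) \<le> (norm y0 * L ^ Suc k / fact k) * \<bar>t\<bar> ^ Suc k / Suc k"
      proof (rule iterated_integral_growth[OF u_deriv u_zero _ Suc.prems])
        fix t assume t: "\<bar>t\<bar> \<le> T"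
        have "norm (A t (u k t)) \<le> L * norm (u k t)" by (rule L[OF t])
        also have "\<dots> \<le> L * (norm y0 * L ^ k / fact k * \<bar>t\<bar> ^ k)"
          using Suc.IH[OF t] \<open>L > 0\<close> by (intro mult_left_mono) auto
        finally show "norm (A t (u k t)) \<le> norm y0 * L ^ Suc k / fact k * \<bar>t\<bar> ^ k"
          by (simp add: mult_ac)
      qed
      then show ?case by (simp add: field_simps)
    qed (simp add: u_simps)
    have "uniform_limit (ball 0 T) (\<lambda>n t. \<Sum>k<n. u k t) Y sequentially"
      unfolding Y_def
    proof (rule Weierstrass_m_test)
      fix n and t :: real assume "t \<in> ball 0 T"
      then have t: "\<bar>t\<bar> \<le> T" by (simp add: dist_norm)
      have "norm (u n t) \<le> norm y0 * L ^ n / fact n * \<bar>t\<bar> ^ n"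
        by (rule u_le[OF t])
      also have "\<dots> \<le> norm y0 * L ^ n / fact n * T ^ n"
        using t \<open>L > 0\<close> by (intro mult_left_mono power_mono) auto
      finally show "norm (u n t) \<le> norm y0 * (inverse (fact n) * (L * T) ^ n)"
        by (simp add: field_simps power_mult_distrib)
    qed (intro summable_mult summable_exp)
    note unif = this
    have lim: "(\<lambda>n. \<Sum>k<n. u k t) \<longlonglongrightarrow> Y t" if "t \<in> ball 0 T" for t
      using tendsto_uniform_limitI[OF unif that] .
    have "\<exists>g. \<forall>t\<in>ball 0 T. (\<lambda>n. \<Sum>k<Suc n. u k t) \<longlonglongrightarrow> g t \<and>
        (g has_derivative (\<lambda>h. h *\<^sub>R A t (Y t))) (at t within ball 0 T)"
    proof (rule has_derivative_sequence[where f' = "\<lambda>n t h. h *\<^sub>R A t (\<Sum>k<n. u k t)" and ?x0.0 = 0])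
      fix n and t :: real assume "t \<in> ball 0 T"
      have "((\<lambda>t. \<Sum>k<Suc n. u k t) has_vector_derivative A t (\<Sum>k<n. u k t)) (at t)"
        unfolding sum.lessThan_Suc_shift linear_sum[OF bounded_linear.linear[OF lin]] u_simps(1)
        by (auto intro!: derivative_eq_intros u_deriv)
      then show "((\<lambda>t. \<Sum>k<Suc n. u k t) has_derivative (\<lambda>h. h *\<^sub>R A t (\<Sum>k<n. u k t)))
          (at t within ball 0 T)"
        by (simp add: has_vector_derivative_def has_derivative_at_withinI)
    next
      fix e :: real assume "e > 0"
      then have "\<forall>\<^sub>F n in sequentially. \<forall>t\<in>ball 0 T. dist (\<Sum>k<n. u k t) (Y t) < e / L"
        using unif \<open>L > 0\<close> by (auto simp: uniform_limit_iff)
      then show "\<forall>\<^sub>F n in sequentially. \<forall>t\<in>ball 0 T. \<forall>h.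
          norm (h *\<^sub>R A t (\<Sum>k<n. u k t) - h *\<^sub>R A t (Y t)) \<le> e * norm h"
      proof (eventually_elim, intro ballI allI)
        fix n and t h :: real
        assume n: "\<forall>t\<in>ball 0 T. dist (\<Sum>k<n. u k t) (Y t) < e / L" and t: "t \<in> ball 0 T"
        have "norm (A t (\<Sum>k<n. u k t) - A t (Y t)) = norm (A t ((\<Sum>k<n. u k t) - Y t))"
          by (simp add: bounded_linear.linear[OF lin] linear_diff)
        also have "\<dots> \<le> L * norm ((\<Sum>k<n. u k t) - Y t)"
          using t by (intro L) (auto simp: dist_norm)
        also have "\<dots> \<le> e"
          using n t \<open>L > 0\<close> by (force simp: dist_norm field_simps)
        finally have "norm (A t (\<Sum>k<n. u k t) - A t (Y t)) * norm h \<le> e * norm h"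
          by (rule mult_right_mono) simp
        then show "norm (h *\<^sub>R A t (\<Sum>k<n. u k t) - h *\<^sub>R A t (Y t)) \<le> e * norm h"
          by (simp add: mult.commute flip: scaleR_diff_right)
      qed
    next
      show "(0::real) \<in> ball 0 T" by (simp add: T_def)
      then show "(\<lambda>n. \<Sum>k<Suc n. u k 0) \<longlonglongrightarrow> Y 0"
        by (intro LIMSEQ_Suc lim)
    qed simp
    then obtain g where g: "\<And>t. t \<in> ball 0 T \<Longrightarrow> (\<lambda>n. \<Sum>k<Suc n. u k t) \<longlonglongrightarrow> g t"
      "\<And>t. t \<in> ball 0 T \<Longrightarrow> (g has_derivative (\<lambda>h. h *\<^sub>R A t (Y t))) (at t within ball 0 T)"
      by blast
    have "g t = Y t" if "t \<in> ball 0 T" for t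
      using LIMSEQ_unique[OF g(1)[OF that] LIMSEQ_Suc[OF lim[OF that]]] .
    moreover have s: "s \<in> ball 0 T" by (simp add: T_def dist_norm)
    ultimately show ?thesis
      using has_derivative_transform_within_open[OF g(2)[OF s] open_ball s, of Y]
      by (simp add: at_within_open[OF s] has_vector_derivative_def)
  qed
  with Y0 show ?thesis by blast
qed

section \<open>Gaussian integrals with complex exponent\<close>

text \<open>
Laplace's trick for \<open>(\<integral>exp(-w s\<^sup>2))\<^sup>2\<close>, in a form that uses only one-dimensional integrals. By
differentiation under the integral sign and the substitution \<open>s = x u\<close>, the left-hand side has
derivative zero in \<open>x\<close>; at \<open>x = 0\<close> it is \<open>\<integral>1/(1+u\<^sup>2) = arctan 1\<close>.
\<close>

lemma gaussian_antiderivative_square: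
  fixes w :: complex and E :: "real \<Rightarrow> complex"
  assumes w: "w \<noteq> 0"
    and E: "\<And>s. (E has_vector_derivative exp (- w * of_real (s\<^sup>2))) (at s)" and E0: "E 0 = 0"
  shows "w * (E x)\<^sup>2 + integral {0..1} (\<lambda>u. exp (- w * of_real (x\<^sup>2 * (1 + u\<^sup>2))) / of_real (1 + u\<^sup>2))
           = of_real (pi / 4)"
proof -
  define h :: "real \<Rightarrow> real \<Rightarrow> complex"
    where "h = (\<lambda>x u. exp (- w * of_real (x\<^sup>2 * (1 + u\<^sup>2))) / of_real (1 + u\<^sup>2))"
  define h' :: "real \<Rightarrow> real \<Rightarrow> complex"
    where "h' = (\<lambda>x u. - 2 * w * of_real x * exp (- w * of_real (x\<^sup>2 * (1 + u\<^sup>2))))"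
  have pos: "1 + u\<^sup>2 \<noteq> 0" for u :: real
    by (smt (verit) zero_le_power2)
  have nz: "1 + (complex_of_real u)\<^sup>2 \<noteq> 0" for u
    using pos[of u] by (metis of_real_1 of_real_add of_real_eq_0_iff of_real_power)
  have nz': "1 + complex_of_real u * complex_of_real u \<noteq> 0" for u
    using nz[of u] by (simp add: power2_eq_square)
  have h_deriv: "((\<lambda>x. h x u) has_vector_derivative h' x u) (at x)" for x u
    unfolding h_def h'_def
    by (rule derivative_eq_intros has_vector_derivative_real_field refl
        | simp add: nz nz' field_simps power2_eq_square)+
  have h_cont: "continuous_on S (\<lambda>u. h x u)" for x S
    unfolding h_def by (intro continuous_intros) (use nz in auto)
  have I_deriv: "((\<lambda>x. integral {0..1} (h x)) has_vector_derivative integral {0..1} (h' x)) (at x)" for x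
  proof -
    have "((\<lambda>x. integral (cbox 0 1) (h x)) has_vector_derivative integral (cbox 0 1) (h' x)) (at x within UNIV)"
    proof (rule leibniz_rule_vector_derivative)
      show "continuous_on (UNIV \<times> cbox 0 1) (\<lambda>(x, u). h' x u)"
        unfolding h'_def split_beta by (intro continuous_intros)
    qed (auto intro!: h_deriv integrable_continuous_interval h_cont)
    then show ?thesis by simp
  qed
  have rescale: "integral {0..1} (h' x) = - 2 * w * exp (- w * of_real (x\<^sup>2)) * E x" for x
  proof -
    have "((\<lambda>u. E (x * u)) has_vector_derivative x *\<^sub>R exp (- w * of_real ((x * u)\<^sup>2))) (at u)" for u
    proof -
      have "((E \<circ> (\<lambda>u. x * u)) has_vector_derivative x *\<^sub>R exp (- w * of_real ((x * u)\<^sup>2))) (at u)"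
        by (rule vector_diff_chain_at[OF _ E]) (auto intro!: derivative_eq_intros)
      then show ?thesis by (simp add: o_def)
    qed
    then have "((\<lambda>u. x *\<^sub>R exp (- w * of_real ((x * u)\<^sup>2))) has_integral E (x * 1) - E (x * 0)) {0..1}"
      by (intro fundamental_theorem_of_calculus) (auto intro: has_vector_derivative_at_within)
    moreover have "exp (- w * of_real (x\<^sup>2 * (1 + u\<^sup>2))) =
        exp (- w * of_real (x\<^sup>2)) * exp (- w * of_real ((x * u)\<^sup>2))" for u
      unfolding exp_add[symmetric] by (simp add: algebra_simps power_mult_distrib)
    then have "h' x = (\<lambda>u. - 2 * w * exp (- w * of_real (x\<^sup>2)) * (x *\<^sub>R exp (- w * of_real ((x * u)\<^sup>2))))"
      unfolding h'_def by (simp only: scaleR_conv_of_real mult_ac)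
    ultimately have "(h' x has_integral - 2 * w * exp (- w * of_real (x\<^sup>2)) * E x) {0..1}"
      using has_integral_mult_right[of "\<lambda>u. x *\<^sub>R exp (- w * of_real ((x * u)\<^sup>2))" "E x" "{0..1}"
          "- 2 * w * exp (- w * of_real (x\<^sup>2))"] by (simp only: E0 mult_1_right mult_zero_right diff_zero)
    then show ?thesis by (rule integral_unique)
  qed
  define \<Phi> where "\<Phi> = (\<lambda>x. w * (E x)\<^sup>2 + integral {0..1} (h x))"
  have "(\<Phi> has_vector_derivative 0) (at x)" for x
  proof -
    have "(\<Phi> has_vector_derivative
        w * (E x * exp (- w * of_real (x\<^sup>2)) + exp (- w * of_real (x\<^sup>2)) * E x) + integral {0..1} (h' x)) (at x)"
      unfolding \<Phi>_def power2_eq_square[of "E _"]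
      by (intro has_vector_derivative_add I_deriv has_vector_derivative_mult_right
            has_vector_derivative_mult E)
    then show ?thesis by (simp add: rescale algebra_simps)
  qed
  then have "\<Phi> x = \<Phi> 0"
    using has_vector_derivative_zero_constant[of UNIV \<Phi>] by (metis UNIV_I convex_UNIV)
  also have "\<Phi> 0 = of_real (pi / 4)"
  proof -
    have "((\<lambda>u. inverse (1 + u\<^sup>2)) has_integral (arctan 1 - arctan 0)) {0..1}"
      by (intro fundamental_theorem_of_calculus)
         (auto intro!: derivative_eq_intros simp flip: has_real_derivative_iff_has_vector_derivative)
    from has_integral_of_real[OF this, where 'b = complex]
    have "((\<lambda>u. h 0 u) has_integral of_real (pi / 4)) {0..1}"
      by (simp add: h_def arctan_one field_simps)
    then show ?thesis by (simp add: \<Phi>_def E0 integral_unique)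
  qed
  finally show ?thesis by (simp add: \<Phi>_def h_def)
qed

lemma laplace_remainder_bound:
  fixes w :: complex
  assumes "0 \<le> Re w"
  shows "norm (integral {0..1} (\<lambda>u. exp (- w * of_real (x\<^sup>2 * (1 + u\<^sup>2))) / of_real (1 + u\<^sup>2)))
           \<le> exp (- Re w * x\<^sup>2) * (pi / 4)"
proof -
  have pos: "1 + u\<^sup>2 > 0" for u :: real
    by (smt (verit) zero_le_power2)
  have "((\<lambda>u. inverse (1 + u\<^sup>2)) has_integral (arctan 1 - arctan 0)) {0..1}"
    by (intro fundamental_theorem_of_calculus)
       (auto intro!: derivative_eq_intros simp flip: has_real_derivative_iff_has_vector_derivative)
  from has_integral_mult_right[OF this, of "exp (- Re w * x\<^sup>2)"]
  have I: "((\<lambda>u. exp (- Re w * x\<^sup>2) * inverse (1 + u\<^sup>2)) has_integral exp (- Re w * x\<^sup>2) * (pi / 4)) {0..1}"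
    by (simp add: arctan_one)
  have "norm (integral {0..1} (\<lambda>u. exp (- w * of_real (x\<^sup>2 * (1 + u\<^sup>2))) / of_real (1 + u\<^sup>2)))
        \<le> integral {0..1} (\<lambda>u. exp (- Re w * x\<^sup>2) * inverse (1 + u\<^sup>2))"
  proof (rule integral_norm_bound_integral)
    show "(\<lambda>u. exp (- w * of_real (x\<^sup>2 * (1 + u\<^sup>2))) / of_real (1 + u\<^sup>2)) integrable_on {0..1}"
      by (intro integrable_continuous_interval continuous_intros) (use pos in \<open>smt (verit) of_real_eq_0_iff\<close>)
    show "(\<lambda>u. exp (- Re w * x\<^sup>2) * inverse (1 + u\<^sup>2)) integrable_on {0..1}"
      using I by blast
    fix u :: real
    have "Re w * x\<^sup>2 \<le> Re w * (x\<^sup>2 * (1 + u\<^sup>2))"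
      using assms by (intro mult_left_mono) (simp_all add: algebra_simps)
    then show "norm (exp (- w * of_real (x\<^sup>2 * (1 + u\<^sup>2))) / of_real (1 + u\<^sup>2))
        \<le> exp (- Re w * x\<^sup>2) * inverse (1 + u\<^sup>2)"
      using pos[of u] by (simp only: norm_divide norm_exp_eq_Re norm_of_real)
        (simp add: divide_inverse mult_right_mono del: of_real_add of_real_mult of_real_power)
  qed
  then show ?thesis unfolding integral_unique[OF I] .
qed

text \<open>
The identity above fixes the limit only up to sign. To select the sign, put
\<open>Q x = csqrt w * E x\<close>. Its square differs from \<open>pi / 4\<close> by less than \<open>pi / 4\<close> for \<open>x > 0\<close>, so \<open>Q\<close>
never meets the imaginary axis there; as \<open>Q\<close> leaves the origin into the right half plane, it
stays in it. Hence \<open>Q\<close> is the principal square root of its square, and convergence of the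
square gives convergence of \<open>Q\<close> itself.
\<close>

theorem gaussian_integral_complex:
  fixes w :: complex and E :: "real \<Rightarrow> complex"
  assumes w: "0 < Re w"
    and E: "\<And>s. (E has_vector_derivative exp (- w * of_real (s\<^sup>2))) (at s)" and E0: "E 0 = 0"
  shows "(E \<longlongrightarrow> of_real (sqrt pi / 2) / csqrt w) at_top"
proof -
  have "w \<noteq> 0" using w by auto
  define J where "J = (\<lambda>x::real. integral {0..1} (\<lambda>u. exp (- w * of_real (x\<^sup>2 * (1 + u\<^sup>2))) / of_real (1 + u\<^sup>2)))"
  define Q where "Q = (\<lambda>x. csqrt w * E x)"
  have Q2: "(Q x)\<^sup>2 = of_real (pi / 4) - J x" for x
    using gaussian_antiderivative_square[OF \<open>w \<noteq> 0\<close> E E0, of x]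
    by (simp add: Q_def J_def power_mult_distrib algebra_simps)
  have J_le: "norm (J x) \<le> exp (- Re w * x\<^sup>2) * (pi / 4)" for x
    unfolding J_def using w by (intro laplace_remainder_bound) simp
  have ReQ_nz: "Re (Q x) \<noteq> 0" if "x > 0" for x
  proof
    assume "Re (Q x) = 0"
    then have "Re ((Q x)\<^sup>2) \<le> 0" by (simp add: power2_eq_square)
    moreover have "exp (- Re w * x\<^sup>2) < 1" using w that by simp
    then have "exp (- Re w * x\<^sup>2) * (pi / 4) < 1 * (pi / 4)"
      by (intro mult_strict_right_mono) auto
    then have "norm (J x) < pi / 4"
      using J_le[of x] by linarith
    then have "Re (J x) < pi / 4"
      using complex_Re_le_cmod[of "J x"] by linarith
    ultimately show False by (simp add: Q2)
  qed
  have Q_deriv: "((\<lambda>x. Re (Q x)) has_real_derivative Re (csqrt w * exp (- w * of_real (x\<^sup>2)))) (at x)" for x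
    unfolding Q_def has_real_derivative_iff_has_vector_derivative
    by (intro bounded_linear.has_vector_derivative[OF bounded_linear_Re] has_vector_derivative_mult_right E)
  have Rew: "Re (csqrt w) > 0"
    using csqrt_principal[of w] w by (smt (verit) csqrt.sel(1) complex_Re_le_cmod divide_pos_pos norm_ge_zero real_sqrt_gt_zero)
  obtain d where d: "d > 0" "\<And>h. 0 < h \<Longrightarrow> h < d \<Longrightarrow> Re (Q (0 + h)) > Re (Q 0)"
    using DERIV_pos_inc_right[OF Q_deriv[of 0]] Rew by auto
  have ReQ_pos: "Re (Q x) > 0" if "x > 0" for x
  proof (rule ccontr)
    assume neg: "\<not> Re (Q x) > 0"
    define y where "y = min x (d/2)"
    have y: "0 < y" "y \<le> x" "y < d" using d(1) that by (auto simp: y_def)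
    have "Re (Q y) > 0" using d(2)[of y] y by (simp add: Q_def E0)
    moreover have "continuous_on {y..x} (\<lambda>x. Re (Q x))"
      by (intro continuous_at_imp_continuous_on ballI DERIV_isCont[OF Q_deriv])
    ultimately obtain z where "y \<le> z" "z \<le> x" "Re (Q z) = 0"
      using IVT2'[of "\<lambda>x. Re (Q x)" x 0 y] neg y by force
    then show False using ReQ_nz[of z] y by simp
  qed
  have "(J \<longlongrightarrow> 0) at_top"
  proof (rule Lim_null_comparison[OF always_eventually])
    have "filterlim (\<lambda>x. Re w * x\<^sup>2) at_top at_top"
      using w by (intro filterlim_tendsto_pos_mult_at_top[OF tendsto_const] filterlim_pow_at_top filterlim_ident) auto
    then have "((\<lambda>x. exp (- (Re w * x\<^sup>2)) * (pi / 4)) \<longlongrightarrow> 0 * (pi / 4)) at_top"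
      by (intro tendsto_mult tendsto_const filterlim_compose[OF exp_at_bot])
         (simp add: filterlim_uminus_at_bot)
    then show "((\<lambda>x. exp (- Re w * x\<^sup>2) * (pi / 4)) \<longlongrightarrow> 0) at_top" by simp
  qed (use J_le in auto)
  then have "((\<lambda>x. csqrt (of_real (pi / 4) - J x)) \<longlongrightarrow> csqrt (of_real (pi / 4) - 0)) at_top"
    by (intro tendsto_compose[OF continuous_at_csqrt[unfolded isCont_def]] tendsto_intros)
       (auto simp: complex_nonpos_Reals_iff not_le)
  also have "csqrt (of_real (pi / 4) - 0) = of_real (sqrt pi / 2)"
    by (simp flip: of_real_sqrt add: real_sqrt_divide)
  finally have "((\<lambda>x. csqrt (of_real (pi / 4) - J x) / csqrt w) \<longlongrightarrow> of_real (sqrt pi / 2) / csqrt w) at_top"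
    using \<open>w \<noteq> 0\<close> by (intro tendsto_divide tendsto_const) auto
  moreover have "\<forall>\<^sub>F x in at_top. csqrt (of_real (pi / 4) - J x) / csqrt w = E x"
    using eventually_gt_at_top[of 0]
  proof eventually_elim
    case (elim x)
    have "csqrt ((Q x)\<^sup>2) = Q x" using ReQ_pos[OF elim] by (intro csqrt_square) auto
    then show ?case using \<open>w \<noteq> 0\<close> by (simp add: Q2) (simp add: Q_def)
  qed
  ultimately show ?thesis
    by (blast intro: Lim_transform_eventually)
qed

section \<open>Scalar solutions of the Serret--Frenet system\<close>

lemma curvature_bounds:
  assumes "0 \<le> \<alpha>" "0 < c0"
  shows "0 < curvature c0 \<alpha> s" "curvature c0 \<alpha> s \<le> c0"
  using assms by (auto simp: curvature_def mult_left_le)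

text \<open>
Each Cartesian coordinate of the frame satisfies the same scalar system, in which the three
vectors are replaced by three real functions \<open>x\<close>, \<open>y\<close>, \<open>z\<close>. All estimates are made for this
scalar system.
\<close>

definition frenet_components ::
  "real \<Rightarrow> real \<Rightarrow> (real \<Rightarrow> real) \<Rightarrow> (real \<Rightarrow> real) \<Rightarrow> (real \<Rightarrow> real) \<Rightarrow> bool" where
  "frenet_components c0 \<alpha> x y z \<longleftrightarrow> (\<forall>s.
     (x has_real_derivative curvature c0 \<alpha> s * y s) (at s) \<and>
     (y has_real_derivative - curvature c0 \<alpha> s * x s + torsion \<alpha> s * z s) (at s) \<and>
     (z has_real_derivative - torsion \<alpha> s * y s) (at s))"

lemma frenet_componentsD:
  assumes "frenet_components c0 \<alpha> x y z"
  shows "(x has_real_derivative curvature c0 \<alpha> s * y s) (at s)"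
    and "(y has_real_derivative - curvature c0 \<alpha> s * x s + torsion \<alpha> s * z s) (at s)"
    and "(z has_real_derivative - torsion \<alpha> s * y s) (at s)"
  using assms by (auto simp: frenet_components_def)

lemma serret_frenet_imp_components:
  assumes "serret_frenet c0 \<alpha> m n b"
  shows "frenet_components c0 \<alpha> (\<lambda>s. m s $ j) (\<lambda>s. n s $ j) (\<lambda>s. b s $ j)"
proof -
  note nth = bounded_linear.has_vector_derivative[OF bounded_linear_vec_nth]
  show ?thesis
    using assms unfolding frenet_components_def serret_frenet_def has_real_derivative_iff_has_vector_derivative
    by (auto dest!: spec intro!: has_vector_derivative_eq_rhs[OF nth])
qed

text \<open>
The coefficient matrix is skew-symmetric, so only the difference of the two curvatures
contributes. Taking \<open>c = c'\<close> yields uniqueness, taking moreover the zero solution yields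
conservation of the norm, and taking \<open>c\<close> different from \<open>c'\<close> yields continuous dependence on \<open>c0\<close>.
\<close>

lemma frenet_squared_distance_derivative:
  assumes "frenet_components c \<alpha> x y z" "frenet_components c' \<alpha> x' y' z'"
  shows "((\<lambda>s. (x s - x' s)\<^sup>2 + (y s - y' s)\<^sup>2 + (z s - z' s)\<^sup>2) has_real_derivative
           2 * (curvature c \<alpha> s - curvature c' \<alpha> s) * (x s * y' s - y s * x' s)) (at s)"
  by (rule derivative_eq_intros frenet_componentsD[OF assms(1)] frenet_componentsD[OF assms(2)] refl
      | simp add: algebra_simps)+

lemma frenet_squared_distance_constant:
  assumes "frenet_components c \<alpha> x y z" "frenet_components c \<alpha> x' y' z'"
  shows "(x s - x' s)\<^sup>2 + (y s - y' s)\<^sup>2 + (z s - z' s)\<^sup>2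
           = (x 0 - x' 0)\<^sup>2 + (y 0 - y' 0)\<^sup>2 + (z 0 - z' 0)\<^sup>2"
  using DERIV_isconst_all[of "\<lambda>s. (x s - x' s)\<^sup>2 + (y s - y' s)\<^sup>2 + (z s - z' s)\<^sup>2" s 0]
    frenet_squared_distance_derivative[OF assms] by simp

lemma frenet_norm_constant:
  assumes "frenet_components c \<alpha> x y z"
  shows "(x s)\<^sup>2 + (y s)\<^sup>2 + (z s)\<^sup>2 = (x 0)\<^sup>2 + (y 0)\<^sup>2 + (z 0)\<^sup>2"
  using frenet_squared_distance_constant[OF assms, of "\<lambda>_. 0" "\<lambda>_. 0" "\<lambda>_. 0" s]
  by (simp add: frenet_components_def)

text \<open>
The three coordinates of the frame at time zero are the rows of the identity matrix, so each
of them starts on the unit sphere, and remains there.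
\<close>

definition unit_frenet_components where
  "unit_frenet_components c0 \<alpha> x y z \<longleftrightarrow>
     frenet_components c0 \<alpha> x y z \<and> (x 0)\<^sup>2 + (y 0)\<^sup>2 + (z 0)\<^sup>2 = 1"

lemma unit_frenet_components_bounded:
  assumes "unit_frenet_components c0 \<alpha> x y z"
  shows "(x s)\<^sup>2 + (y s)\<^sup>2 + (z s)\<^sup>2 = 1" "\<bar>x s\<bar> \<le> 1" "\<bar>y s\<bar> \<le> 1" "\<bar>z s\<bar> \<le> 1"
proof -
  show *: "(x s)\<^sup>2 + (y s)\<^sup>2 + (z s)\<^sup>2 = 1"
    using assms frenet_norm_constant[of c0 \<alpha> x y z s] by (simp add: unit_frenet_components_def)
  show "\<bar>x s\<bar> \<le> 1" "\<bar>y s\<bar> \<le> 1" "\<bar>z s\<bar> \<le> 1"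
    unfolding abs_square_le_1[symmetric] using * by (smt (verit) zero_le_power2)+
qed

section \<open>The Serret--Frenet frame\<close>

theorem serret_frenet_exists:
  assumes "0 \<le> \<alpha>" "0 < c0"
  shows "\<exists>m n b. serret_frenet c0 \<alpha> m n b"
proof -
  define A :: "real \<Rightarrow> (real^3) \<times> (real^3) \<times> (real^3) \<Rightarrow> (real^3) \<times> (real^3) \<times> (real^3)" where
    "A = (\<lambda>s v. (curvature c0 \<alpha> s *\<^sub>R fst (snd v),
                 - curvature c0 \<alpha> s *\<^sub>R fst v + torsion \<alpha> s *\<^sub>R snd (snd v),
                 - torsion \<alpha> s *\<^sub>R fst (snd v)))"
  have "\<exists>y. y 0 = (vector [1, 0, 0], vector [0, 1, 0], vector [0, 0, 1]) \<and>
      (\<forall>s. (y has_vector_derivative A s (y s)) (at s))"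
  proof (rule linear_ode_global_solution)
    show "bounded_linear (A s)" for s
      unfolding linear_conv_bounded_linear[symmetric] A_def
      by (rule linearI) (auto simp: algebra_simps)
    show "continuous_on UNIV (\<lambda>s. A s (y s))" if "continuous_on UNIV y" for y
      unfolding A_def curvature_def torsion_def by (intro continuous_intros that) auto
    fix T
    show "\<exists>L. \<forall>s v. \<bar>s\<bar> \<le> T \<longrightarrow> norm (A s v) \<le> L * norm v"
    proof (intro exI allI impI)
      fix s :: real and v :: "(real^3) \<times> (real^3) \<times> (real^3)"
      assume s: "\<bar>s\<bar> \<le> T"
      define t where "t = \<bar>sqrt (1 - \<alpha>\<^sup>2)\<bar> * T / 2"
      have c: "\<bar>curvature c0 \<alpha> s\<bar> \<le> c0"
        using curvature_bounds[OF assms, of s] by simp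
      have \<tau>: "\<bar>torsion \<alpha> s\<bar> \<le> t"
        using mult_left_mono[OF s, of "\<bar>sqrt (1 - \<alpha>\<^sup>2)\<bar>"]
        unfolding torsion_def t_def abs_divide abs_mult by (simp add: field_simps)
      have v1: "norm (fst v) \<le> norm v" by (cases v) (simp add: norm_fst_le)
      have v2: "norm (fst (snd v)) \<le> norm v"
        by (cases v) (auto intro: order_trans[OF norm_fst_le norm_snd_le])
      have v3: "norm (snd (snd v)) \<le> norm v"
        by (cases v) (auto intro: order_trans[OF norm_snd_le norm_snd_le])
      have "norm (A s v) \<le> norm (curvature c0 \<alpha> s *\<^sub>R fst (snd v)) +
          (norm (- curvature c0 \<alpha> s *\<^sub>R fst v + torsion \<alpha> s *\<^sub>R snd (snd v)) +
           norm (- torsion \<alpha> s *\<^sub>R fst (snd v)))"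
        unfolding A_def by (intro order_trans[OF norm_Pair_le] add_mono order_refl)
      also have "\<dots> \<le> c0 * norm v + ((c0 * norm v + t * norm v) + t * norm v)"
        using c \<tau> v1 v2 v3
        by (intro add_mono order_trans[OF norm_triangle_ineq]) (auto intro!: mult_mono)
      finally show "norm (A s v) \<le> (2 * c0 + 2 * t) * norm v"
        by (simp add: algebra_simps)
    qed
  qed
  then obtain v where v0: "v 0 = (vector [1, 0, 0], vector [0, 1, 0], vector [0, 0, 1])"
    and v: "\<And>s. (v has_vector_derivative A s (v s)) (at s)"
    by blast
  note proj = bounded_linear.has_vector_derivative[OF _ v]
  have "serret_frenet c0 \<alpha> (\<lambda>s. fst (v s)) (\<lambda>s. fst (snd (v s))) (\<lambda>s. snd (snd (v s)))"
    unfolding serret_frenet_def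
    using proj[OF bounded_linear_fst]
      proj[OF bounded_linear_compose[OF bounded_linear_fst bounded_linear_snd]]
      proj[OF bounded_linear_compose[OF bounded_linear_snd bounded_linear_snd]]
    by (simp add: A_def v0)
  then show ?thesis by blast
qed

lemma serret_frenet_unique:
  assumes "serret_frenet c0 \<alpha> m n b" "serret_frenet c0 \<alpha> m' n' b'"
  shows "m = m' \<and> n = n' \<and> b = b'"
proof -
  have "m s $ j = m' s $ j \<and> n s $ j = n' s $ j \<and> b s $ j = b' s $ j" for s j
  proof -
    have "(m s $ j - m' s $ j)\<^sup>2 + (n s $ j - n' s $ j)\<^sup>2 + (b s $ j - b' s $ j)\<^sup>2
        = (m 0 $ j - m' 0 $ j)\<^sup>2 + (n 0 $ j - n' 0 $ j)\<^sup>2 + (b 0 $ j - b' 0 $ j)\<^sup>2"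
      by (rule frenet_squared_distance_constant; rule serret_frenet_imp_components; fact)
    also have "\<dots> = 0" using assms by (simp add: serret_frenet_def)
    finally show ?thesis by (smt (verit) zero_le_power2 zero_eq_power2)
  qed
  then show ?thesis by (simp add: fun_eq_iff vec_eq_iff)
qed

lemma serret_frenet_tangent:
  assumes "0 \<le> \<alpha>" "0 < c0"
  obtains n b where "serret_frenet c0 \<alpha> (tangent c0 \<alpha>) n b"
proof -
  obtain m n b where mnb: "serret_frenet c0 \<alpha> m n b"
    using serret_frenet_exists[OF assms] by blast
  then have "frenet_frame c0 \<alpha> = (m, n, b)"
    unfolding frenet_frame_def
    by (intro the_equality) (auto dest: serret_frenet_unique)
  with mnb that show ?thesis by (simp add: tangent_def)
qed

lemma tangent_components:
  assumes "0 \<le> \<alpha>" "0 < c0"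
  obtains y z where "unit_frenet_components c0 \<alpha> (\<lambda>s. tangent c0 \<alpha> s $ j) y z"
    "tangent c0 \<alpha> 0 $ j = (if j = 1 then 1 else 0)"
    "y 0 = (if j = 2 then 1 else 0)" "z 0 = (if j = 3 then 1 else 0)"
proof -
  obtain n b where nb: "serret_frenet c0 \<alpha> (tangent c0 \<alpha>) n b"
    using serret_frenet_tangent[OF assms] .
  have init: "tangent c0 \<alpha> 0 $ j = (if j = 1 then 1 else 0)"
    "n 0 $ j = (if j = 2 then 1 else 0)" "b 0 $ j = (if j = 3 then 1 else 0)"
    using nb exhaust_3[of j] by (auto simp: serret_frenet_def)
  have "unit_frenet_components c0 \<alpha> (\<lambda>s. tangent c0 \<alpha> s $ j) (\<lambda>s. n s $ j) (\<lambda>s. b s $ j)"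
    using serret_frenet_imp_components[OF nb, of j] init exhaust_3[of j]
    by (auto simp: unit_frenet_components_def)
  with init that show ?thesis by blast
qed

text \<open>
The derivative of the squared distance is at most \<open>2 * \<bar>c - c'\<bar>\<close> in absolute value, because the
curvatures differ by at most \<open>\<bar>c - c'\<bar>\<close> and \<open>x y' - y x'\<close> is a two-dimensional determinant of
vectors of length at most one.
\<close>

lemma frenet_distance_le:
  assumes "unit_frenet_components c \<alpha> x y z" "unit_frenet_components c' \<alpha> x' y' z'"
    and init: "x 0 = x' 0" "y 0 = y' 0" "z 0 = z' 0"
    and "0 \<le> \<alpha>" "0 \<le> s"
  shows "(x s - x' s)\<^sup>2 \<le> 2 * \<bar>c - c'\<bar> * s"
proof -
  define D where "D = (\<lambda>s. (x s - x' s)\<^sup>2 + (y s - y' s)\<^sup>2 + (z s - z' s)\<^sup>2)"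
  have "norm (D s - D 0) \<le> 2 * \<bar>c - c'\<bar> * s - 2 * \<bar>c - c'\<bar> * 0"
  proof (rule increment_le_of_derivative_le[OF \<open>0 \<le> s\<close>])
    fix t
    show "(D has_vector_derivative
        2 * (curvature c \<alpha> t - curvature c' \<alpha> t) * (x t * y' t - y t * x' t)) (at t)"
      unfolding D_def has_real_derivative_iff_has_vector_derivative[symmetric]
      by (rule frenet_squared_distance_derivative)
         (use assms in \<open>simp_all add: unit_frenet_components_def\<close>)
    show "((\<lambda>s. 2 * \<bar>c - c'\<bar> * s) has_real_derivative 2 * \<bar>c - c'\<bar>) (at t)"
      by (auto intro!: derivative_eq_intros)
    have "\<bar>x t * y' t - y t * x' t\<bar> \<le> 1"
    proof -
      have "\<bar>x t * y' t - y t * x' t\<bar> \<le> ((x t)\<^sup>2 + (y' t)\<^sup>2 + (y t)\<^sup>2 + (x' t)\<^sup>2) / 2"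
        using sum_squares_bound[of "x t" "y' t"] sum_squares_bound[of "y t" "x' t"]
          sum_squares_bound[of "x t" "- y' t"] sum_squares_bound[of "y t" "- x' t"]
        unfolding abs_le_iff by (simp add: field_simps)
      also have "\<dots> \<le> 1"
        using unit_frenet_components_bounded(1)[OF assms(1), of t]
          unit_frenet_components_bounded(1)[OF assms(2), of t]
          zero_le_power2[of "z t"] zero_le_power2[of "z' t"] by argo
      finally show ?thesis .
    qed
    moreover have "\<bar>curvature c \<alpha> t - curvature c' \<alpha> t\<bar> \<le> \<bar>c - c'\<bar>"
      using \<open>0 \<le> \<alpha>\<close>
      by (simp add: curvature_def abs_mult mult_left_le flip: left_diff_distrib)
    ultimately show "norm (2 * (curvature c \<alpha> t - curvature c' \<alpha> t) * (x t * y' t - y t * x' t))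
        \<le> 2 * \<bar>c - c'\<bar>"
      using mult_mono[of "\<bar>curvature c \<alpha> t - curvature c' \<alpha> t\<bar>" "\<bar>c - c'\<bar>" "\<bar>x t * y' t - y t * x' t\<bar>" 1]
      unfolding real_norm_def abs_mult by simp
  qed
  moreover have "D 0 = 0" by (simp add: D_def init)
  moreover have "(x s - x' s)\<^sup>2 \<le> D s" by (simp add: D_def)
  ultimately show ?thesis by simp
qed

lemma tangent_continuous_in_c0:
  assumes "0 \<le> \<alpha>" "0 \<le> s"
  shows "continuous_on {0<..} (\<lambda>c0. tangent c0 \<alpha> s $ j)"
  unfolding continuous_on_def
proof
  fix c :: real assume c: "c \<in> {0<..}"
  obtain y z where yz: "unit_frenet_components c \<alpha> (\<lambda>s. tangent c \<alpha> s $ j) y z"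
    "tangent c \<alpha> 0 $ j = (if j = 1 then 1 else 0)"
    "y 0 = (if j = 2 then 1 else 0)" "z 0 = (if j = 3 then 1 else 0)"
    using tangent_components[OF assms(1), of c j] c by auto
  have "((\<lambda>c'. (tangent c' \<alpha> s $ j - tangent c \<alpha> s $ j)\<^sup>2) \<longlongrightarrow> 0) (at c within {0<..})"
  proof (rule tendsto_sandwich[OF _ _ tendsto_const])
    show "((\<lambda>c'. 2 * \<bar>c' - c\<bar> * s) \<longlongrightarrow> 0) (at c within {0<..})"
      by (auto intro!: tendsto_eq_intros)
    show "\<forall>\<^sub>F c' in at c within {0<..}.
        (tangent c' \<alpha> s $ j - tangent c \<alpha> s $ j)\<^sup>2 \<le> 2 * \<bar>c' - c\<bar> * s"
      unfolding eventually_at_filter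
    proof (intro always_eventually allI impI)
      fix c' :: real assume c': "c' \<in> {0<..}"
      obtain y' z' where yz': "unit_frenet_components c' \<alpha> (\<lambda>s. tangent c' \<alpha> s $ j) y' z'"
        "tangent c' \<alpha> 0 $ j = (if j = 1 then 1 else 0)"
        "y' 0 = (if j = 2 then 1 else 0)" "z' 0 = (if j = 3 then 1 else 0)"
        using tangent_components[OF assms(1), of c' j] c' by auto
      show "(tangent c' \<alpha> s $ j - tangent c \<alpha> s $ j)\<^sup>2 \<le> 2 * \<bar>c' - c\<bar> * s"
        by (rule frenet_distance_le[OF yz'(1) yz(1)]) (use yz yz' assms in simp_all)
    qed
  qed simp
  from tendsto_real_sqrt[OF this]
  have "((\<lambda>c'. tangent c' \<alpha> s $ j - tangent c \<alpha> s $ j) \<longlongrightarrow> 0) (at c within {0<..})"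
    by (simp add: tendsto_rabs_zero_iff)
  then show "((\<lambda>c'. tangent c' \<alpha> s $ j) \<longlongrightarrow> tangent c \<alpha> s $ j) (at c within {0<..})"
    by (simp add: LIM_zero_iff)
qed

text \<open>
This is the complex Gaussian integral at the real exponent \<open>\<alpha> / 4\<close>. The upper bound holds at
every point because the antiderivative of a positive function increases to its limit.
\<close>

lemma real_gaussian_antiderivative:
  assumes "0 < \<alpha>"
  obtains G where "\<And>s. (G has_real_derivative exp (- \<alpha> * s\<^sup>2 / 4)) (at s)" "G 0 = 0"
    "(G \<longlongrightarrow> sqrt (pi / \<alpha>)) at_top" "\<And>s. G s \<le> sqrt (pi / \<alpha>)"
proof -
  obtain E :: "real \<Rightarrow> complex" where E0: "E 0 = 0"
    and E: "\<And>s. (E has_vector_derivative exp (- of_real (\<alpha> / 4) * of_real (s\<^sup>2))) (at s)"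
    using antiderivative_from_zero[of "\<lambda>s. exp (- of_real (\<alpha> / 4) * of_real (s\<^sup>2)) :: complex",
        OF continuous_on_exp[OF continuous_on_mult_left]] continuous_on_of_real[OF continuous_on_power[OF continuous_on_id]]
    by blast
  define G where "G = (\<lambda>s. Re (E s))"
  have G: "(G has_real_derivative exp (- \<alpha> * s\<^sup>2 / 4)) (at s)" for s
  proof -
    have "(G has_vector_derivative Re (exp (- of_real (\<alpha> / 4) * of_real (s\<^sup>2)))) (at s)"
      unfolding G_def by (rule bounded_linear.has_vector_derivative[OF bounded_linear_Re E])
    also have "- of_real (\<alpha> / 4) * of_real (s\<^sup>2) = complex_of_real (- \<alpha> * s\<^sup>2 / 4)"
      by simp
    finally show ?thesis
      by (simp only: exp_of_real Re_complex_of_real has_real_derivative_iff_has_vector_derivative)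
  qed
  have lim: "(G \<longlongrightarrow> sqrt (pi / \<alpha>)) at_top"
  proof -
    have "(G \<longlongrightarrow> Re (of_real (sqrt pi / 2) / csqrt (of_real (\<alpha> / 4)))) at_top"
      unfolding G_def by (intro tendsto_Re gaussian_integral_complex[OF _ E E0]) (use assms in simp)
    also have "csqrt (of_real (\<alpha> / 4)) = of_real (sqrt (\<alpha> / 4))"
      using assms by (subst of_real_sqrt) auto
    also have "Re (of_real (sqrt pi / 2) / of_real (sqrt (\<alpha> / 4))) = sqrt (pi / \<alpha>)"
      unfolding of_real_divide[symmetric] Re_complex_of_real by (simp add: real_sqrt_divide)
    finally show ?thesis .
  qed
  have "mono G"
    by (rule monoI, rule DERIV_nonneg_imp_nondecreasing[of _ _ G]) (use G in \<open>force+\<close>)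
  then have "G s \<le> sqrt (pi / \<alpha>)" for s
    by (intro tendsto_lowerbound[OF lim])
       (auto simp: mono_def intro: eventually_mono[OF eventually_ge_at_top[of s]])
  with G lim that show ?thesis by (force simp: G_def E0)
qed

section \<open>The limiting vector and its continuity\<close>

text \<open>
Cauchy's criterion with a rate: the rate for the increments is inherited by the distance to
the limit. The rate is what makes the convergence uniform in a parameter.
\<close>

lemma limit_with_modulus:
  fixes f :: "real \<Rightarrow> real"
  assumes r: "(r \<longlongrightarrow> 0) at_top"
    and f: "\<And>s S. 0 < s \<Longrightarrow> s \<le> S \<Longrightarrow> \<bar>f S - f s\<bar> \<le> r s"
  obtains l where "(f \<longlongrightarrow> l) at_top" "\<And>s. 0 < s \<Longrightarrow> \<bar>l - f s\<bar> \<le> r s"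
proof -
  have "cauchy_filter (filtermap f at_top)"
    unfolding cauchy_filter_metric_filtermap
  proof (intro allI impI)
    fix e :: real assume "e > 0"
    then have "\<forall>\<^sub>F s in at_top. r s < e / 2 \<and> 0 < s"
      using order_tendstoD(2)[OF r, of "e / 2"] by (auto intro: eventually_conj eventually_gt_at_top)
    then obtain s where s: "r s < e / 2" "0 < s"
      by (auto simp: eventually_at_top_linorder)
    show "\<exists>P. eventually P at_top \<and> (\<forall>x y. P x \<and> P y \<longrightarrow> dist (f x) (f y) < e)"
    proof (intro exI[of _ "\<lambda>x. s \<le> x"] conjI allI impI)
      fix x y assume "s \<le> x \<and> s \<le> y"
      then show "dist (f x) (f y) < e"
        using f[OF s(2), of x] f[OF s(2), of y] s(1) by (simp add: dist_real_def)
    qed (rule eventually_ge_at_top)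
  qed
  then obtain l where "filtermap f at_top \<le> nhds l"
    using cauchy_filter_complete_converges[of "filtermap f at_top" UNIV] complete_UNIV
    by (auto simp: filtermap_bot_iff)
  then have l: "(f \<longlongrightarrow> l) at_top" by (simp add: filterlim_def)
  moreover have "\<bar>l - f s\<bar> \<le> r s" if "0 < s" for s
  proof (rule tendsto_upperbound)
    show "((\<lambda>S. \<bar>f S - f s\<bar>) \<longlongrightarrow> \<bar>l - f s\<bar>) at_top"
      by (intro tendsto_intros l)
    show "\<forall>\<^sub>F S in at_top. \<bar>f S - f s\<bar> \<le> r s"
      using eventually_ge_at_top[of s] by eventually_elim (rule f[OF that])
  qed simp
  ultimately show ?thesis using that by blast
qed

text \<open>
The tangent converges with a rate that depends on \<open>c0\<close> only through a linear factor. For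
\<open>\<alpha> > 0\<close> the curvature is integrable. For \<open>\<alpha> = 0\<close> it is constant, and convergence is due to the
fast rotation: since \<open>z' = - s y / 2\<close>, adding \<open>2 c0 z / s\<close> to \<open>x\<close> amounts to an integration by
parts and leaves a function with derivative \<open>- 2 c0 z / s\<^sup>2\<close>, which is integrable at infinity.
\<close>

lemma tangent_tail_bound:
  assumes "0 \<le> \<alpha>"
  shows "\<exists>r. (r \<longlongrightarrow> 0) at_top \<and> (\<forall>c0 x y z s S. 0 < c0 \<longrightarrow> unit_frenet_components c0 \<alpha> x y z \<longrightarrow>
           0 < s \<longrightarrow> s \<le> S \<longrightarrow> \<bar>x S - x s\<bar> \<le> c0 * r s)"
proof (cases "\<alpha> = 0")
  case False
  with assms have "0 < \<alpha>" by simp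
  then obtain G where G: "\<And>s. (G has_real_derivative exp (- \<alpha> * s\<^sup>2 / 4)) (at s)" "G 0 = 0"
    "(G \<longlongrightarrow> sqrt (pi / \<alpha>)) at_top" "\<And>s. G s \<le> sqrt (pi / \<alpha>)"
    using real_gaussian_antiderivative by blast
  show ?thesis
  proof (intro exI[of _ "\<lambda>s. sqrt (pi / \<alpha>) - G s"] conjI allI impI)
    show "((\<lambda>s. sqrt (pi / \<alpha>) - G s) \<longlongrightarrow> 0) at_top"
      by (auto intro!: tendsto_eq_intros G)
    fix c0 s S :: real and x y z
    assume c0: "0 < c0" and u: "unit_frenet_components c0 \<alpha> x y z" and s: "0 < s" "s \<le> S"
    have "norm (x S - x s) \<le> c0 * G S - c0 * G s"
    proof (rule increment_le_of_derivative_le[OF s(2)])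
      fix t
      show "(x has_vector_derivative curvature c0 \<alpha> t * y t) (at t)"
        using u frenet_componentsD(1)[of c0 \<alpha> x y z t]
        by (simp add: unit_frenet_components_def has_real_derivative_iff_has_vector_derivative)
      show "((\<lambda>s. c0 * G s) has_real_derivative curvature c0 \<alpha> t) (at t)"
        unfolding curvature_def by (intro DERIV_cmult G)
      show "norm (curvature c0 \<alpha> t * y t) \<le> curvature c0 \<alpha> t"
        using curvature_bounds[OF assms c0, of t] unit_frenet_components_bounded(3)[OF u, of t]
        by (simp add: abs_mult mult_left_le)
    qed
    also have "\<dots> \<le> c0 * (sqrt (pi / \<alpha>) - G s)"
      using c0 G(4)[of S] by (simp add: algebra_simps)
    finally show "\<bar>x S - x s\<bar> \<le> c0 * (sqrt (pi / \<alpha>) - G s)" by simp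
  qed
next
  case [simp]: True
  show ?thesis
  proof (intro exI[of _ "\<lambda>s. 6 / s"] conjI allI impI)
    show "((\<lambda>s::real. 6 / s) \<longlongrightarrow> 0) at_top"
      by (intro tendsto_divide_0[OF tendsto_const] filterlim_at_top_imp_at_infinity filterlim_ident)
    fix c0 s S :: real and x y z
    assume c0: "0 < c0" and u: "unit_frenet_components c0 \<alpha> x y z" and s: "0 < s" "s \<le> S"
    from u have fc: "frenet_components c0 0 x y z" by (simp add: unit_frenet_components_def)
    define f where "f = (\<lambda>s. x s + 2 * c0 * z s / s)"
    have "norm (f S - f s) \<le> - 2 * c0 / S - (- 2 * c0 / s)"
    proof (rule increment_le_of_derivative_le[OF s(2)])
      fix t assume "s \<le> t"
      then have t: "0 < t" using s by simp
      have "(f has_real_derivative - 2 * c0 * z t / t\<^sup>2) (at t)"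
        unfolding f_def
        by (rule derivative_eq_intros frenet_componentsD(1,3)[OF fc] refl
            | use t in \<open>simp add: curvature_def torsion_def field_simps power2_eq_square\<close>)+
      then show "(f has_vector_derivative - 2 * c0 * z t / t\<^sup>2) (at t)"
        by (simp add: has_real_derivative_iff_has_vector_derivative)
      show "((\<lambda>t. - 2 * c0 / t) has_real_derivative 2 * c0 / t\<^sup>2) (at t)"
        by (rule derivative_eq_intros refl | use t in \<open>simp add: field_simps power2_eq_square\<close>)+
      show "norm (- 2 * c0 * z t / t\<^sup>2) \<le> 2 * c0 / t\<^sup>2"
        using unit_frenet_components_bounded(4)[OF u, of t] c0
        by (simp add: abs_mult divide_right_mono mult_left_le)
    qed
    moreover have "\<bar>2 * c0 * z t / t\<bar> \<le> 2 * c0 / s" if "s \<le> t" for t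
    proof -
      have "\<bar>2 * c0 * z t / t\<bar> = 2 * c0 * \<bar>z t\<bar> / t"
        using c0 s that by (simp add: abs_mult)
      also have "\<dots> \<le> 2 * c0 * 1 / s"
        using unit_frenet_components_bounded(4)[OF u, of t] c0 s that
        by (intro frac_le mult_left_mono mult_nonneg_nonneg) auto
      finally show ?thesis by simp
    qed
    from this[of s] this[of S] have "\<bar>2 * c0 * z s / s\<bar> \<le> 2 * c0 / s" "\<bar>2 * c0 * z S / S\<bar> \<le> 2 * c0 / s"
      using s by auto
    moreover have "0 \<le> 2 * c0 / S" using c0 s by simp
    ultimately have "\<bar>x S - x s\<bar> \<le> 6 * c0 / s"
      unfolding f_def real_norm_def by linarith
    then show "\<bar>x S - x s\<bar> \<le> c0 * (6 / s)" by (simp add: mult.commute)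
  qed
qed

lemma tangent_tendsto_limit_vector:
  assumes "0 \<le> \<alpha>"
  obtains r where "(r \<longlongrightarrow> 0) at_top"
    "\<And>c0. 0 < c0 \<Longrightarrow> (tangent c0 \<alpha> \<longlongrightarrow> limit_vector c0 \<alpha>) at_top"
    "\<And>c0 s j. 0 < c0 \<Longrightarrow> 0 < s \<Longrightarrow> \<bar>limit_vector c0 \<alpha> $ j - tangent c0 \<alpha> s $ j\<bar> \<le> c0 * r s"
proof -
  obtain r where r: "(r \<longlongrightarrow> 0) at_top"
    and tail: "\<And>c0 x y z s S. 0 < c0 \<Longrightarrow> unit_frenet_components c0 \<alpha> x y z \<Longrightarrow>
           0 < s \<Longrightarrow> s \<le> S \<Longrightarrow> \<bar>x S - x s\<bar> \<le> c0 * r s"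
    using tangent_tail_bound[OF assms] by metis
  have *: "\<exists>l. ((\<lambda>s. tangent c0 \<alpha> s $ j) \<longlongrightarrow> l) at_top \<and> (\<forall>s>0. \<bar>l - tangent c0 \<alpha> s $ j\<bar> \<le> c0 * r s)"
    if "0 < c0" for c0 j
  proof -
    obtain y z where u: "unit_frenet_components c0 \<alpha> (\<lambda>s. tangent c0 \<alpha> s $ j) y z"
      using tangent_components[OF assms \<open>0 < c0\<close>] by metis
    show ?thesis
    proof (rule limit_with_modulus)
      show "((\<lambda>s. c0 * r s) \<longlongrightarrow> 0) at_top" by (auto intro!: tendsto_eq_intros r)
      show "\<bar>tangent c0 \<alpha> S $ j - tangent c0 \<alpha> s $ j\<bar> \<le> c0 * r s" if "0 < s" "s \<le> S" for s S
        by (rule tail[OF \<open>0 < c0\<close> u that])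
    qed blast
  qed
  have "(tangent c0 \<alpha> \<longlongrightarrow> limit_vector c0 \<alpha>) at_top \<and>
      (\<forall>j. \<forall>s>0. \<bar>limit_vector c0 \<alpha> $ j - tangent c0 \<alpha> s $ j\<bar> \<le> c0 * r s)" if pos: "0 < c0" for c0
  proof -
    obtain l where l: "\<And>j. ((\<lambda>s. tangent c0 \<alpha> s $ j) \<longlongrightarrow> l j) at_top"
      "\<And>j s. s > 0 \<Longrightarrow> \<bar>l j - tangent c0 \<alpha> s $ j\<bar> \<le> c0 * r s"
      using *[OF pos] by metis
    have lim: "(tangent c0 \<alpha> \<longlongrightarrow> (\<chi> j. l j)) at_top"
      by (rule vec_tendstoI) (simp add: l)
    then have "limit_vector c0 \<alpha> = (\<chi> j. l j)"
      unfolding limit_vector_def by (intro tendsto_Lim) auto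
    with lim l(2) show ?thesis by simp
  qed
  with r that show ?thesis by blast
qed

text \<open>
On bounded sets of \<open>c0\<close> the tangent at time \<open>s\<close> converges uniformly to the limiting vector, and
for fixed \<open>s\<close> it depends continuously on \<open>c0\<close>.
\<close>

theorem limit_vector_continuous:
  assumes "0 \<le> \<alpha>"
  shows "continuous_on {0<..} (\<lambda>c0. limit_vector c0 \<alpha>)"
proof -
  obtain r where r: "(r \<longlongrightarrow> 0) at_top"
    and tail: "\<And>c0 s j. 0 < c0 \<Longrightarrow> 0 < s \<Longrightarrow>
      \<bar>limit_vector c0 \<alpha> $ j - tangent c0 \<alpha> s $ j\<bar> \<le> c0 * r s"
    using tangent_tendsto_limit_vector[OF assms] by metis
  have bounded: "continuous_on {0<..<M} (\<lambda>c0. limit_vector c0 \<alpha> $ j)" for M j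
  proof (rule uniform_limit_theorem)
    show "\<forall>\<^sub>F s in at_top. continuous_on {0<..<M} (\<lambda>c0. tangent c0 \<alpha> s $ j)"
      using eventually_ge_at_top[of 0]
      by eventually_elim (auto intro: continuous_on_subset[OF tangent_continuous_in_c0[OF assms]])
    show "uniform_limit {0<..<M} (\<lambda>s c0. tangent c0 \<alpha> s $ j) (\<lambda>c0. limit_vector c0 \<alpha> $ j) at_top"
    proof (rule uniform_limitI)
      fix e :: real assume "e > 0"
      have "((\<lambda>s. M * \<bar>r s\<bar>) \<longlongrightarrow> 0) at_top"
        by (auto intro!: tendsto_eq_intros r)
      then have "\<forall>\<^sub>F s in at_top. M * \<bar>r s\<bar> < e"
        using \<open>e > 0\<close> by (rule order_tendstoD)
      then show "\<forall>\<^sub>F s in at_top. \<forall>c0\<in>{0<..<M}. dist (tangent c0 \<alpha> s $ j) (limit_vector c0 \<alpha> $ j) < e"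
        using eventually_gt_at_top[of 0]
      proof eventually_elim
        case (elim s)
        show ?case
        proof
          fix c0 assume c0: "c0 \<in> {0<..<M}"
          have "c0 * r s \<le> M * \<bar>r s\<bar>"
            using c0 by (intro order_trans[OF mult_left_mono[OF abs_ge_self] mult_right_mono]) auto
          then show "dist (tangent c0 \<alpha> s $ j) (limit_vector c0 \<alpha> $ j) < e"
            using tail[of c0 s j] c0 elim by (simp add: dist_real_def abs_minus_commute)
        qed
      qed
    qed
  qed simp
  have "isCont (\<lambda>c0. limit_vector c0 \<alpha> $ j) c" if "0 < c" for c j
    using bounded[of "c + 1" j] that by (simp add: continuous_on_eq_continuous_at)
  then have "continuous_on {0<..} (\<lambda>c0. \<chi> j. limit_vector c0 \<alpha> $ j)"
    by (intro continuous_on_vec_lambda continuous_at_imp_continuous_on) auto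
  then show ?thesis by simp
qed

section \<open>First order expansion of the limiting vector\<close>

text \<open>
Let \<open>P\<close> be \<open>y + \<i> z\<close> seen in a frame rotating with the accumulated torsion,
\<open>P s = exp (\<i> \<beta> s\<^sup>2 / 4) * (y s + \<i> z s)\<close>. The torsion then disappears from the equations:
the derivative of \<open>P\<close> is \<open>- c x exp (\<i> \<beta> s\<^sup>2 / 4)\<close>, where \<open>c\<close> is the curvature, and the
derivative of \<open>x\<close> is \<open>c0 * Re (exp (- w s\<^sup>2) * P s)\<close>. Since \<open>\<bar>x\<bar> \<le> 1\<close>, \<open>P\<close> moves by at most
\<open>c0 * G s\<close>, the integral of the curvature. Replacing \<open>P\<close> by its initial value in the equation for
\<open>x\<close> therefore costs at most the integral of the curvature times its own antiderivative, which
is half the square of the latter.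
\<close>

lemma frenet_first_order_expansion:
  fixes \<alpha> :: real and E :: "real \<Rightarrow> complex"
  defines "w \<equiv> Complex (\<alpha> / 4) (sqrt (1 - \<alpha>\<^sup>2) / 4)"
  assumes u: "unit_frenet_components c0 \<alpha> x y z" and "0 < c0" "0 \<le> \<alpha>" "0 \<le> s"
    and G: "\<And>s. (G has_real_derivative exp (- \<alpha> * s\<^sup>2 / 4)) (at s)" "G 0 = 0"
    and E: "\<And>s. (E has_vector_derivative exp (- w * of_real (s\<^sup>2))) (at s)" "E 0 = 0"
  shows "\<bar>x s - x 0 - c0 * Re (Complex (y 0) (z 0) * E s)\<bar> \<le> c0\<^sup>2 * (G s)\<^sup>2 / 2"
proof -
  define \<beta> where "\<beta> = sqrt (1 - \<alpha>\<^sup>2)"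
  define N where "N = (\<lambda>s. Complex (y s) (z s))"
  define R where "R = (\<lambda>s. exp (\<i> * of_real (\<beta> * s\<^sup>2 / 4)))"
  define P where "P = (\<lambda>s. R s * N s)"
  note fc = frenet_componentsD[OF u[unfolded unit_frenet_components_def, THEN conjunct1]]
  have P0: "P 0 = N 0" by (simp add: P_def R_def)
  have normR: "norm (R s) = 1" for s by (simp add: R_def)
  have K: "((\<lambda>s. c0 * G s) has_real_derivative curvature c0 \<alpha> s) (at s)" for s
    unfolding curvature_def by (intro DERIV_cmult G)
  have N_deriv: "(N has_vector_derivative
      - of_real (curvature c0 \<alpha> s * x s) - \<i> * of_real (torsion \<alpha> s) * N s) (at s)" for s
  proof -
    have "((\<lambda>s. of_real (y s) + \<i> * of_real (z s)) has_vector_derivative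
        of_real (- curvature c0 \<alpha> s * x s + torsion \<alpha> s * z s) + \<i> * of_real (- torsion \<alpha> s * y s)) (at s)"
      by (intro has_vector_derivative_add has_vector_derivative_mult_right fc has_vector_derivative_of_real)
    then show ?thesis
      by (simp add: N_def Complex_eq[abs_def] algebra_simps)
  qed
  have R_deriv: "(R has_vector_derivative \<i> * of_real (torsion \<alpha> s) * R s) (at s)" for s
    unfolding R_def torsion_def \<beta>_def[symmetric]
    by (rule derivative_eq_intros has_vector_derivative_real_field refl | simp)+
  have P_deriv: "(P has_vector_derivative - of_real (curvature c0 \<alpha> s * x s) * R s) (at s)" for s
  proof -
    have "(P has_vector_derivative R s * (- of_real (curvature c0 \<alpha> s * x s) - \<i> * of_real (torsion \<alpha> s) * N s)
        + (\<i> * of_real (torsion \<alpha> s) * R s) * N s) (at s)"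
      unfolding P_def by (intro has_vector_derivative_mult R_deriv N_deriv)
    then show ?thesis by (simp add: algebra_simps)
  qed
  have P_le: "norm (P t - P 0) \<le> c0 * G t" if "0 \<le> t" for t
  proof -
    have "norm (P t - P 0) \<le> c0 * G t - c0 * G 0"
    proof (rule increment_le_of_derivative_le[OF that P_deriv K])
      fix t
      show "norm (- of_real (curvature c0 \<alpha> t * x t) * R t) \<le> curvature c0 \<alpha> t"
        using curvature_bounds[OF \<open>0 \<le> \<alpha>\<close> \<open>0 < c0\<close>, of t] unit_frenet_components_bounded(2)[OF u, of t]
        by (simp add: norm_mult normR abs_mult mult_left_le del: of_real_mult)
    qed
    then show ?thesis by (simp add: G)
  qed
  have kernel: "of_real c0 * exp (- w * of_real (t\<^sup>2)) * R t = of_real (curvature c0 \<alpha> t)" for t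
  proof -
    have "exp (- w * of_real (t\<^sup>2)) * R t = exp (- w * of_real (t\<^sup>2) + \<i> * of_real (\<beta> * t\<^sup>2 / 4))"
      by (simp only: R_def exp_add)
    also have "- w * of_real (t\<^sup>2) + \<i> * of_real (\<beta> * t\<^sup>2 / 4) = of_real (- \<alpha> * t\<^sup>2 / 4)"
      by (simp add: w_def \<beta>_def complex_eq_iff)
    finally show ?thesis
      by (simp only: curvature_def mult.assoc exp_of_real of_real_mult)
  qed
  define f where "f = (\<lambda>s. x s - c0 * Re (P 0 * E s))"
  have f_deriv: "(f has_vector_derivative
      c0 * Re (exp (- w * of_real (t\<^sup>2)) * (P t - P 0))) (at t)" for t
  proof -
    have "curvature c0 \<alpha> t * y t = Re (of_real (curvature c0 \<alpha> t) * N t)"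
      by (simp add: N_def)
    also have "\<dots> = c0 * Re (exp (- w * of_real (t\<^sup>2)) * P t)"
      unfolding kernel[symmetric] P_def by (simp add: mult.assoc del: of_real_power)
    finally have *: "curvature c0 \<alpha> t * y t - c0 * Re (P 0 * exp (- w * of_real (t\<^sup>2)))
        = c0 * Re (exp (- w * of_real (t\<^sup>2)) * (P t - P 0))"
      by (simp add: algebra_simps)
    show ?thesis
      unfolding f_def *[symmetric]
      using fc(1)[of t] unfolding has_real_derivative_iff_has_vector_derivative
      by (intro has_vector_derivative_diff has_vector_derivative_mult_right
            bounded_linear.has_vector_derivative[OF bounded_linear_Re] E)
  qed
  have "norm (f s - f 0) \<le> (c0 * G s)\<^sup>2 / 2 - (c0 * G 0)\<^sup>2 / 2"
  proof (rule increment_le_of_derivative_le[OF \<open>0 \<le> s\<close> f_deriv])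
    fix t :: real assume "0 \<le> t"
    show "((\<lambda>s. (c0 * G s)\<^sup>2 / 2) has_real_derivative curvature c0 \<alpha> t * (c0 * G t)) (at t)"
      by (rule derivative_eq_intros K refl | simp)+
    have "norm (c0 * Re (exp (- w * of_real (t\<^sup>2)) * (P t - P 0)))
        \<le> c0 * norm (exp (- w * of_real (t\<^sup>2)) * (P t - P 0))"
      using \<open>0 < c0\<close> mult_left_mono[OF abs_Re_le_cmod, of c0]
      unfolding real_norm_def abs_mult by (simp del: times_complex.sel minus_complex.sel)
    also have "\<dots> = curvature c0 \<alpha> t * norm (P t - P 0)"
      by (simp add: norm_mult norm_exp_eq_Re w_def curvature_def)
    also have "\<dots> \<le> curvature c0 \<alpha> t * (c0 * G t)"
      using curvature_bounds[OF \<open>0 \<le> \<alpha>\<close> \<open>0 < c0\<close>, of t] P_le[OF \<open>0 \<le> t\<close>]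
      by (intro mult_left_mono) auto
    finally show "norm (c0 * Re (exp (- w * of_real (t\<^sup>2)) * (P t - P 0)))
        \<le> curvature c0 \<alpha> t * (c0 * G t)" .
  qed
  moreover have "x s - x 0 - c0 * Re (Complex (y 0) (z 0) * E s) = f s - f 0"
    by (simp add: f_def P0 N_def E)
  ultimately show ?thesis
    by (simp add: G power_mult_distrib)
qed

text \<open>
Letting \<open>s\<close> tend to infinity in the first order expansion. The Gaussian integral is
\<open>sqrt pi / csqrt (4 w)\<close>, where \<open>4 w = \<alpha> + \<i> \<beta>\<close> has modulus one; its real and imaginary parts
are given by the half-angle formulas and produce the linear terms of the second and third
coordinates. The error is half the square of \<open>c0 * sqrt (pi / \<alpha>)\<close>, the
total curvature of the half line.
\<close>

lemma limit_vector_first_order: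
  assumes "0 < \<alpha>" "\<alpha> \<le> 1" "0 < c0"
  shows "\<bar>limit_vector c0 \<alpha> $ j - ((if j = 1 then 1 else 0)
            + (if j = 2 then c0 * (sqrt (pi * (1 + \<alpha>)) / sqrt 2) else 0)
            + (if j = 3 then c0 * (sqrt (pi * (1 - \<alpha>)) / sqrt 2) else 0))\<bar>
         \<le> c0\<^sup>2 * pi / (2 * \<alpha>)"
proof -
  define w where "w = Complex (\<alpha> / 4) (sqrt (1 - \<alpha>\<^sup>2) / 4)"
  obtain G where G: "\<And>s. (G has_real_derivative exp (- \<alpha> * s\<^sup>2 / 4)) (at s)" "G 0 = 0"
    "(G \<longlongrightarrow> sqrt (pi / \<alpha>)) at_top" "\<And>s. G s \<le> sqrt (pi / \<alpha>)"
    using real_gaussian_antiderivative[OF assms(1)] by blast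
  obtain E :: "real \<Rightarrow> complex" where E: "\<And>s. (E has_vector_derivative exp (- w * of_real (s\<^sup>2))) (at s)" "E 0 = 0"
    using antiderivative_from_zero[of "\<lambda>s. exp (- w * of_real (s\<^sup>2)) :: complex",
        OF continuous_on_exp[OF continuous_on_mult_left]] continuous_on_of_real[OF continuous_on_power[OF continuous_on_id]]
    by blast
  define l where "l = of_real (sqrt pi / 2) / csqrt w"
  have E_lim: "(E \<longlongrightarrow> l) at_top"
    unfolding l_def by (rule gaussian_integral_complex[OF _ E]) (use assms in \<open>simp add: w_def\<close>)
  obtain y z where yz: "unit_frenet_components c0 \<alpha> (\<lambda>s. tangent c0 \<alpha> s $ j) y z"
    "tangent c0 \<alpha> 0 $ j = (if j = 1 then 1 else 0)"
    "y 0 = (if j = 2 then 1 else 0)" "z 0 = (if j = 3 then 1 else 0)"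
    using tangent_components[OF less_imp_le[OF assms(1)] assms(3)] .
  have m_lim: "((\<lambda>s. tangent c0 \<alpha> s $ j) \<longlongrightarrow> limit_vector c0 \<alpha> $ j) at_top"
    using tangent_tendsto_limit_vector[OF less_imp_le[OF assms(1)]] tendsto_vec_nth assms(3) by metis
  have "\<bar>limit_vector c0 \<alpha> $ j - tangent c0 \<alpha> 0 $ j - c0 * Re (Complex (y 0) (z 0) * l)\<bar>
      \<le> c0\<^sup>2 * (sqrt (pi / \<alpha>))\<^sup>2 / 2"
  proof (rule tendsto_le[OF trivial_limit_at_top_linorder])
    show "((\<lambda>s. \<bar>tangent c0 \<alpha> s $ j - tangent c0 \<alpha> 0 $ j - c0 * Re (Complex (y 0) (z 0) * E s)\<bar>) \<longlongrightarrow>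
        \<bar>limit_vector c0 \<alpha> $ j - tangent c0 \<alpha> 0 $ j - c0 * Re (Complex (y 0) (z 0) * l)\<bar>) at_top"
      by (intro tendsto_intros m_lim E_lim)
    show "((\<lambda>s. c0\<^sup>2 * (G s)\<^sup>2 / 2) \<longlongrightarrow> c0\<^sup>2 * (sqrt (pi / \<alpha>))\<^sup>2 / 2) at_top"
      by (intro tendsto_intros G) simp
    show "\<forall>\<^sub>F s in at_top. \<bar>tangent c0 \<alpha> s $ j - tangent c0 \<alpha> 0 $ j - c0 * Re (Complex (y 0) (z 0) * E s)\<bar>
        \<le> c0\<^sup>2 * (G s)\<^sup>2 / 2"
      using eventually_ge_at_top[of 0]
    proof eventually_elim
      case (elim s)
      show ?case
        by (rule frenet_first_order_expansion[OF yz(1) _ _ elim G(1,2) E[unfolded w_def]])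
           (use assms in auto)
    qed
  qed
  moreover have "Complex (y 0) (z 0) * l = of_real (y 0) * l + of_real (z 0) * (\<i> * l)"
    by (simp add: Complex_eq algebra_simps)
  moreover have "l = Complex (sqrt (pi * (1 + \<alpha>)) / sqrt 2) (- (sqrt (pi * (1 - \<alpha>)) / sqrt 2))"
  proof -
    define p q where "p = sqrt ((1 + \<alpha>) / 8)" and "q = sqrt ((1 - \<alpha>) / 8)"
    have "\<alpha>\<^sup>2 \<le> 1" using assms by (simp add: power_le_one)
    then have "cmod w = 1 / 4"
      by (simp add: w_def complex_norm power_divide real_sqrt_divide flip: add_divide_distrib)
    \<comment> \<open>The principal square root of a real number has its own case; here it occurs only for \<open>w = 1 / 4\<close>, where \<open>q = 0\<close>.\<close>
    moreover have "\<alpha> = 1" if "\<not> sqrt (1 - \<alpha>\<^sup>2) > 0"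
    proof -
      have "(1 - \<alpha>) * (1 + \<alpha>) \<le> 0" using that by (simp add: algebra_simps power2_eq_square)
      then show ?thesis using assms by (simp add: mult_le_0_iff)
    qed
    ultimately have csqrt_w: "csqrt w = Complex p q"
      by (auto simp: complex_eq_iff w_def p_def q_def sgn_if add_divide_distrib diff_divide_distrib)
    have pq: "4 * p\<^sup>2 + 4 * q\<^sup>2 = 1" using assms by (simp add: p_def q_def field_simps)
    have "l = Complex (2 * sqrt pi * p) (- (2 * sqrt pi * q))"
      unfolding l_def csqrt_w by (simp add: complex_eq_iff Re_divide Im_divide pq)
    moreover have "2 * sqrt pi * sqrt (t / 8) = sqrt (pi * t) / sqrt 2" for t
    proof -
      have "sqrt 8 = 2 * sqrt 2" using real_sqrt_mult[of 4 2] by simp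
      then show ?thesis by (simp add: real_sqrt_mult real_sqrt_divide)
    qed
    ultimately show ?thesis by (simp add: p_def q_def)
  qed
  ultimately show ?thesis
    using yz(2-4) assms exhaust_3[of j] by (auto simp: real_sqrt_pow2)
qed

theorem theorem1p3:
  fixes \<alpha> :: real
  assumes "0 \<le> \<alpha>" and "\<alpha> \<le> 1"
  shows "continuous_on {0<..} (\<lambda>c0. limit_vector c0 \<alpha>) \<and>
    (0 < \<alpha> \<longrightarrow> (\<forall>c0>0.
       \<bar>limit_vector c0 \<alpha> $ 1 - 1\<bar>
         \<le> c0\<^sup>2 * pi / \<alpha> * (1 + c0\<^sup>2 * pi / (8 * \<alpha>)) \<and>
       \<bar>limit_vector c0 \<alpha> $ 2 - c0 * (sqrt (pi * (1 + \<alpha>)) / sqrt 2)\<bar>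
         \<le> c0\<^sup>2 * pi / 4
           + c0\<^sup>2 * pi / (\<alpha> * sqrt 2)
             * (1 + c0\<^sup>2 * pi / 8 + c0 * (sqrt (pi * (1 + \<alpha>)) / (2 * sqrt 2)))
           + (c0\<^sup>2 * pi / (2 * sqrt 2 * \<alpha>))\<^sup>2 \<and>
       \<bar>limit_vector c0 \<alpha> $ 3 - c0 * (sqrt (pi * (1 - \<alpha>)) / sqrt 2)\<bar>
         \<le> c0\<^sup>2 * pi / 4
           + c0\<^sup>2 * pi / (\<alpha> * sqrt 2)
             * (1 + c0\<^sup>2 * pi / 8 + c0 * (sqrt (pi * (1 - \<alpha>)) / (2 * sqrt 2)))
           + (c0\<^sup>2 * pi / (2 * sqrt 2 * \<alpha>))\<^sup>2))"
proof (intro conjI impI allI)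
  show "continuous_on {0<..} (\<lambda>c0. limit_vector c0 \<alpha>)"
    by (rule limit_vector_continuous[OF assms(1)])
next
  fix c0 :: real assume \<alpha>: "0 < \<alpha>" and c0: "0 < c0"
  note first_order = limit_vector_first_order[OF \<alpha> assms(2) c0]
  define X where "X = c0\<^sup>2 * pi / \<alpha>"
  have X: "0 \<le> X" using \<alpha> by (simp add: X_def)
  have half: "c0\<^sup>2 * pi / (2 * \<alpha>) = X / 2" by (simp add: X_def)
  have "X / 2 \<le> X * 1" using X by simp
  also have "\<dots> \<le> X * (1 + c0\<^sup>2 * pi / (8 * \<alpha>))"
    using \<alpha> by (intro mult_left_mono X) simp
  finally show "\<bar>limit_vector c0 \<alpha> $ 1 - 1\<bar> \<le> c0\<^sup>2 * pi / \<alpha> * (1 + c0\<^sup>2 * pi / (8 * \<alpha>))"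
    using first_order[of 1] by (simp add: half flip: X_def)
  \<comment> \<open>It suffices that \<open>sqrt 2 \<le> 2\<close>: already the term of order \<open>c0\<^sup>2\<close> with denominator \<open>\<alpha> * sqrt 2\<close> exceeds the error.\<close>
  have dominated: "c0\<^sup>2 * pi / (2 * \<alpha>) \<le> c0\<^sup>2 * pi / 4
           + c0\<^sup>2 * pi / (\<alpha> * sqrt 2) * (1 + c0\<^sup>2 * pi / 8 + c0 * (sqrt (pi * t) / (2 * sqrt 2)))
           + (c0\<^sup>2 * pi / (2 * sqrt 2 * \<alpha>))\<^sup>2" if "0 \<le> t" for t
  proof -
    have "sqrt 2 \<le> 2" by (simp add: real_le_lsqrt)
    then have "c0\<^sup>2 * pi / (2 * \<alpha>) \<le> c0\<^sup>2 * pi / (\<alpha> * sqrt 2) * 1"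
      using \<alpha> by (simp add: divide_left_mono)
    also have "\<dots> \<le> c0\<^sup>2 * pi / (\<alpha> * sqrt 2) * (1 + c0\<^sup>2 * pi / 8 + c0 * (sqrt (pi * t) / (2 * sqrt 2)))"
      using \<alpha> c0 that by (intro mult_left_mono) auto
    finally show ?thesis
      using zero_le_power2[of "c0\<^sup>2 * pi / (2 * sqrt 2 * \<alpha>)"] mult_nonneg_nonneg[OF zero_le_power2[of c0] pi_ge_zero]
      by linarith
  qed
  show "\<bar>limit_vector c0 \<alpha> $ 2 - c0 * (sqrt (pi * (1 + \<alpha>)) / sqrt 2)\<bar>
         \<le> c0\<^sup>2 * pi / 4
           + c0\<^sup>2 * pi / (\<alpha> * sqrt 2)
             * (1 + c0\<^sup>2 * pi / 8 + c0 * (sqrt (pi * (1 + \<alpha>)) / (2 * sqrt 2)))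
           + (c0\<^sup>2 * pi / (2 * sqrt 2 * \<alpha>))\<^sup>2"
    using first_order[of 2] dominated[of "1 + \<alpha>"] \<alpha> by simp
  show "\<bar>limit_vector c0 \<alpha> $ 3 - c0 * (sqrt (pi * (1 - \<alpha>)) / sqrt 2)\<bar>
         \<le> c0\<^sup>2 * pi / 4
           + c0\<^sup>2 * pi / (\<alpha> * sqrt 2)
             * (1 + c0\<^sup>2 * pi / 8 + c0 * (sqrt (pi * (1 - \<alpha>)) / (2 * sqrt 2)))
           + (c0\<^sup>2 * pi / (2 * sqrt 2 * \<alpha>))\<^sup>2"
    using first_order[of 3] dominated[of "1 - \<alpha>"] assms(2) by simp
qed

end
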